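(* For all integers $k \geq 0$ and $n \geq 0$, the assembly procedure $\Phi^k_n$ (described in the context), which assigns to each planar rooted forest with $k+1$ trees and $n$ total edges the leaf that it contributes to the $k$-extended action graph $A^k_n$, defines a bijection between the set of planar rooted forests with $k+1$ trees and $n$ total edges and the set of leaves of $A^k_n$.
   Context: Directed graphs: a directed graph is a pair $(V,E)$ where $V$ is a set of vertices and $E$ is a set of ordered pairs of vertices, called edges; the edge $e=(v,w)$ has source $s(e) = v$ and target $t(e) = w$. It is assumed that $(v,v) \in E$ for every $v \in V$; these edges are called trivial edges, and there are no other loops and no multiple edges. A (directed) path is a sequence of edges $e_1, \ldots, e_m$ ($m \geq 1$) with $t(e_i) = s(e_{i+1})$ for $1 \leq i < m$, where if $m > 1$ all the edges are required to be nontrivial. Its initial vertex is $s(e_1)$ and its terminal vertex is $t(e_m)$. In particular, each vertex $v$ gives exactly one trivial path from $v$ to $v$. A labeling of a directed graph by a set $S$ is a function $V \to S$. $k$-extended action graphs: for $k \geq 0$, the graphs $A^k_n$, $n \geq 0$, are directed graphs labeled by $\mathbb{N} \cup \{-k, -k+1, \ldots, -1\}$ (with $0\in\mathbb{N}$; for $k=0$ the label set is $\mathbb{N}$), defined inductively. The graph $A^k_0$ is the linear graph $\bullet_{-k} \to \bullet_{-k+1} \to \cdots \to \bullet_{-1} \to \bullet_0$ with $k+1$ vertices labeled $-k, \ldots, 0$ (for $k=0$ it is a single vertex labeled $0$ with no nontrivial edges). Given $A^k_n$, the graph $A^k_{n+1}$ is obtained by freely adjoining new edges as follows: for each vertex $v$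 of $A^k_n$ labeled by $n$ and each path in $A^k_n$ with terminal vertex $v$ (including the trivial path at $v$), adjoin one new edge whose source is the initial vertex of that path and whose target is a new vertex labeled by $n+1$ (distinct paths give distinct new vertices). Leaves: ignoring trivial edges, $A^k_n$ is a tree, rooted at the vertex labeled $-k$. A leaf of a rooted tree is a vertex of valence $1$ that is not the root; in a tree consisting of a single vertex, that vertex is both the root and a leaf. The leaves of $A^k_n$ are precisely its vertices labeled by $n$. Planar rooted forests: a planar rooted tree is a (finite) rooted tree in which the children of each vertex carry a left-to-right linear order, considered up to isomorphism preserving the root and these orders; a single vertex is allowed. A planar rooted forest with $k+1$ trees is an ordered $(k+1)$-tuple of planar rooted trees (repetitions allowed), arranged from left to right; its number of edges is the total over its trees. Canonical labeling: in a planar rooted forest with $k+1$ trees and $n$ edges, the roots are labeled, from left to right, $-k, -k+1, \ldots, -1, 0$. The $n$ non-root vertices are then labeled $1, 2, \ldots, n$ working from bottom to top and from right to left: the trees are treated from right to left, and within each tree the vertices are visited in depth-first order in which each vertex precedes its descendants and, among the children of a vertex, each child together with all of its descendants is visited before any child to its left. The procedure $\Phi^k_n$, defined recursively in $n$: the unique planar rooted forest with $k+1$ trees and no edges is sent by $\Phi^k_0$ to the vertex of $A^k_0$ labeled $0$. For a planar rooted forest $F$ with $k+1$ trees and $n+1$ edges, let $p$ be the label of the parent, in $F$, of the vertex labeled $n+1$, and let $F'$ be the forest with $n$ edges obtained from $F$ by deleting the vertex labeled $n+1$ (necessarily a childless vertex) and the edge joining it to its parent. Let $v' = \Phi^k_n(F')$,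 a vertex of $A^k_n$ labeled $n$. Consider the path in $A^k_n$ with terminal vertex $v'$ whose initial vertex is the vertex with label $p$ lying on the directed path from the vertex labeled $-k$ to $v'$ (this is the trivial path at $v'$ if $p=n$). Then $\Phi^k_{n+1}(F)$ is the new vertex labeled $n+1$ of $A^k_{n+1}$ adjoined for this path. Labels strictly increase along nontrivial edges, so there is at most one such initial vertex; its existence is part of the assertion that the procedure is well defined. *)

theory Defs
  imports "Graph_Theory.Pair_Digraph"
begin

section \<open>Labeled directed graphs and their paths\<close>

text \<open>
  The label function only matters on the vertex set.
\<close>

record 'v labeled_digraph =
  dgraph :: "'v pair_pre_digraph"
  vlab :: "'v \<Rightarrow> int"

abbreviation vertices :: "'v labeled_digraph \<Rightarrow> 'v set" where
  "vertices G \<equiv> pverts (dgraph G)"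

abbreviation edges :: "'v labeled_digraph \<Rightarrow> ('v \<times> 'v) set" where
  "edges G \<equiv> parcs (dgraph G)"

text \<open>
  Every vertex of the graphs below carries its trivial edge, so the trivial path at \<open>v\<close> is
  \<open>[(v, v)]\<close>. The empty arc list, which is a walk in the sense of the library, is not a path,
  and paths of length greater than one use nontrivial edges only.
\<close>

definition dpath :: "'v labeled_digraph \<Rightarrow> 'v \<Rightarrow> ('v \<times> 'v) list \<Rightarrow> 'v \<Rightarrow> bool" where
  "dpath G u p v \<longleftrightarrow>
     p \<noteq> [] \<and> pre_digraph.awalk (with_proj (dgraph G)) u p v \<and>
     (length p > 1 \<longrightarrow> (\<forall>e \<in> set p. fst e \<noteq> snd e))"

definition valence :: "'v labeled_digraph \<Rightarrow> 'v \<Rightarrow> nat" where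
  "valence G v = card {e \<in> edges G. fst e \<noteq> snd e \<and> (fst e = v \<or> snd e = v)}"

definition leaves :: "'v labeled_digraph \<Rightarrow> 'v \<Rightarrow> 'v set" where
  "leaves G r = {v \<in> vertices G. (v \<noteq> r \<and> valence G v = 1) \<or> vertices G = {r}}"


section \<open>Extended action graphs\<close>

text \<open>
  \<open>Base i\<close> is the vertex labeled \<open>i\<close> of the initial linear graph, and \<open>Adj p\<close> is the new vertex
  adjoined for the path \<open>p\<close>. The path determines its terminal vertex, so distinct pairs of a
  vertex and a path ending there give distinct new vertices.
\<close>

datatype vertex = Base int | Adj "(vertex \<times> vertex) list"

definition initial_graph :: "nat \<Rightarrow> vertex labeled_digraph" where
  "initial_graph k =
     (let V = Base ` {- int k..0} in
      \<lparr> dgraph = \<lparr> pverts = V,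
                   parcs = {(v, v) | v. v \<in> V} \<union> {(Base i, Base (i + 1)) | i. - int k \<le> i \<and> i < 0} \<rparr>,
        vlab = (\<lambda>v. case v of Base i \<Rightarrow> i | Adj _ \<Rightarrow> 0) \<rparr>)"

definition paths_to_label :: "vertex labeled_digraph \<Rightarrow> nat \<Rightarrow> (vertex \<times> vertex) list set" where
  "paths_to_label G n = {p. \<exists>u v. dpath G u p v \<and> vlab G v = int n}"

definition adjoin :: "vertex labeled_digraph \<Rightarrow> nat \<Rightarrow> vertex labeled_digraph" where
  "adjoin G n =
     (let P = paths_to_label G n; N = Adj ` P in
      \<lparr> dgraph = \<lparr> pverts = vertices G \<union> N,
                   parcs = edges G \<union> {(v, v) | v. v \<in> N} \<union> {(fst (hd p), Adj p) | p. p \<in> P} \<rparr>,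
        vlab = (\<lambda>v. if v \<in> N then int n + 1 else vlab G v) \<rparr>)"

primrec action_graph :: "nat \<Rightarrow> nat \<Rightarrow> vertex labeled_digraph" where
  "action_graph k 0 = initial_graph k"
| "action_graph k (Suc n) = adjoin (action_graph k n) n"

definition action_root :: "nat \<Rightarrow> vertex" where
  "action_root k = Base (- int k)"

lemma dpath_snd_last: "dpath G u p v \<Longrightarrow> snd (last p) = v"
proof -
  have "pcas u p v \<Longrightarrow> p \<noteq> [] \<Longrightarrow> snd (last p) = v"
    by (induction p arbitrary: u) auto
  then show "dpath G u p v \<Longrightarrow> snd (last p) = v"
    by (simp add: dpath_def pre_digraph.awalk_def cas_with_proj_eq)
qed

lemma action_graph_edges_vertices:
  "(u, v) \<in> edges (action_graph k n) \<Longrightarrow> v \<in> vertices (action_graph k n)"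
  by (induction n) (auto simp: initial_graph_def adjoin_def Let_def)

lemma dpath_terminal_vertex:
  assumes "dpath (action_graph k n) u p v"
  shows "v \<in> vertices (action_graph k n)"
proof -
  have "last p \<in> edges (action_graph k n)"
    using assms by (auto simp: dpath_def pre_digraph.awalk_def)
  then show ?thesis
    using dpath_snd_last[OF assms] action_graph_edges_vertices[of "fst (last p)"] by auto
qed

lemma action_graph_adjoined_label:
  "Adj p \<in> vertices (action_graph k n) \<Longrightarrow>
     snd (last p) \<in> vertices (action_graph k n) \<and>
     vlab (action_graph k n) (snd (last p)) < int n"
proof (induction n arbitrary: p)
  case 0
  then show ?case by (auto simp: initial_graph_def Let_def)
next
  case (Suc n)
  let ?G = "action_graph k n"
  have new: "snd (last q) \<in> vertices ?G \<and> vlab ?G (snd (last q)) = int n"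
    if "q \<in> paths_to_label ?G n" for q
    using that by (auto simp: paths_to_label_def dest: dpath_terminal_vertex dpath_snd_last)
  have fresh: "v \<notin> Adj ` paths_to_label ?G n" if "v \<in> vertices ?G" for v
    using that new Suc.IH by fastforce
  from Suc.prems consider "Adj p \<in> vertices ?G" | "p \<in> paths_to_label ?G n"
    by (auto simp: adjoin_def Let_def)
  then show ?case
    using Suc.IH[of p] new[of p] fresh[of "snd (last p)"]
    by cases (auto simp: adjoin_def Let_def)
qed

lemma adjoined_vertices_new:
  "Adj ` paths_to_label (action_graph k n) n \<inter> vertices (action_graph k n) = {}"
proof -
  have "Adj p \<notin> vertices (action_graph k n)" if "p \<in> paths_to_label (action_graph k n) n" for p
    using that action_graph_adjoined_label[of p k n] dpath_snd_last
    by (fastforce simp: paths_to_label_def)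
  then show ?thesis by auto
qed


section \<open>Planar rooted forests\<close>

text \<open>
  The list contains the subtrees at the children of the root, from left to right. Isomorphism
  classes of finite planar rooted trees correspond exactly to the elements of this datatype.
\<close>

datatype ptree = Node (subtrees: "ptree list")

primrec num_edges :: "ptree \<Rightarrow> nat" where
  "num_edges (Node ts) = length ts + sum_list (map num_edges ts)"

definition planar_forests :: "nat \<Rightarrow> nat \<Rightarrow> ptree list set" where
  "planar_forests k n = {F. length F = k + 1 \<and> sum_list (map num_edges F) = n}"

text \<open>
  A vertex of a forest is addressed by the nonempty list \<open>i # c\<^sub>1 # \<dots> # c\<^sub>m\<close>: start at the root of
  the \<open>i\<close>-th tree from the left and go successively to the \<open>c\<^sub>j\<close>-th child from the left (all
  counted from 0). The parent of a non-root vertex \<open>w\<close> is thus \<open>butlast w\<close>.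

  \<open>descendants T\<close> lists the non-root vertices of \<open>T\<close>, addressed relative to the root of \<open>T\<close>, in
  depth-first order from bottom to top (parents first) and from right to left.
\<close>

primrec descendants :: "ptree \<Rightarrow> nat list list" where
  "descendants (Node ts) =
     concat (rev (map2 (\<lambda>i ws. [i] # map ((#) i) ws) [0..<length ts] (map descendants ts)))"

definition forest_roots :: "ptree list \<Rightarrow> nat list list" where
  "forest_roots F = map (\<lambda>i. [i]) [0..<length F]"

definition forest_nonroots :: "ptree list \<Rightarrow> nat list list" where
  "forest_nonroots F =
     concat (rev (map2 (\<lambda>i T. map ((#) i) (descendants T)) [0..<length F] F))"

definition forest_vertices :: "ptree list \<Rightarrow> nat list list" where
  "forest_vertices F = forest_roots F @ forest_nonroots F"

text \<open>
  For a forest with \<open>k + 1\<close> trees and \<open>n\<close> edges, the vertices listed by \<open>forest_vertices\<close>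
  are labeled consecutively by \<open>- k, \<dots>, n\<close>.
\<close>

definition canonical_label :: "nat \<Rightarrow> ptree list \<Rightarrow> nat list \<Rightarrow> int" where
  "canonical_label k F w =
     (THE l. \<exists>i < length (forest_vertices F). forest_vertices F ! i = w \<and> l = int i - int k)"

definition vertex_labeled :: "nat \<Rightarrow> ptree list \<Rightarrow> int \<Rightarrow> nat list" where
  "vertex_labeled k F l = (THE w. w \<in> set (forest_vertices F) \<and> canonical_label k F w = l)"

text \<open>
  \<open>delete_vertex w F\<close> removes the vertex with address \<open>w\<close>, the edge to its parent and
  everything above it; it is only applied to childless non-root vertices.
\<close>

fun delete_vertex :: "nat list \<Rightarrow> ptree list \<Rightarrow> ptree list" where
  "delete_vertex [] ts = ts"
| "delete_vertex [i] ts = take i ts @ drop (Suc i) ts"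
| "delete_vertex (i # j # w) ts = ts[i := Node (delete_vertex (j # w) (subtrees (ts ! i)))]"


section \<open>The assembly procedure\<close>

text \<open>
  The next two functions are meant for forests \<open>F\<close> with \<open>k + 1\<close> trees and \<open>n + 1\<close> edges.
\<close>

definition parent_label :: "nat \<Rightarrow> nat \<Rightarrow> ptree list \<Rightarrow> int" where
  "parent_label k n F = canonical_label k F (butlast (vertex_labeled k F (int n + 1)))"

definition truncate_forest :: "nat \<Rightarrow> nat \<Rightarrow> ptree list \<Rightarrow> ptree list" where
  "truncate_forest k n F = delete_vertex (vertex_labeled k F (int n + 1)) F"

definition attaching_path ::
    "nat \<Rightarrow> nat \<Rightarrow> vertex \<Rightarrow> int \<Rightarrow> (vertex \<times> vertex) list \<Rightarrow> bool" where
  "attaching_path k n v l q \<longleftrightarrow>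
     (\<exists>u. dpath (action_graph k n) u q v \<and> vlab (action_graph k n) u = l \<and>
          (\<exists>r. dpath (action_graph k n) (action_root k) r v \<and>
               u \<in> set (pawalk_verts (action_root k) r)))"

primrec assembly :: "nat \<Rightarrow> nat \<Rightarrow> ptree list \<Rightarrow> vertex" where
  "assembly k 0 F = Base 0"
| "assembly k (Suc n) F =
     Adj (THE q. attaching_path k n (assembly k n (truncate_forest k n F)) (parent_label k n F) q)"

end

theory Submission
  imports Defs
begin

text \<open>
  Since \<open>A\<^sup>k\<^sub>n\<close> is a tree with strictly increasing labels, a vertex labeled \<open>n + 1\<close> amounts to a
  vertex \<open>v\<close> labeled \<open>n\<close> together with the label \<open>p\<close> of an ancestor of \<open>v\<close>, and the ancestor labels
  of the new vertex are those of \<open>v\<close> up to \<open>p\<close>, followed by \<open>n + 1\<close>. Likewise, a forest with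
  \<open>n + 1\<close> edges amounts to a forest with \<open>n\<close> edges together with the label \<open>p\<close> of a vertex to which a
  new last vertex can be attached, and attaching it changes the set of these labels by the
  same rule. So by induction the two sets of choices agree under the assembly procedure.
\<close>

section \<open>Labeled rooted trees with trivial edges\<close>

definition nontrivial :: "'v labeled_digraph \<Rightarrow> ('v \<times> 'v) set" where
  "nontrivial G = {e \<in> edges G. fst e \<noteq> snd e}"

text \<open>The reflexive closure includes the label of \<open>v\<close> itself, matching the
  trivial path at \<open>v\<close>.\<close>

definition ancestor_labels :: "'v labeled_digraph \<Rightarrow> 'v \<Rightarrow> int set" where
  "ancestor_labels G v = vlab G ` {u. (u, v) \<in> (nontrivial G)\<^sup>*}"

section \<open>Walks as edge lists, and their relation to reachability\<close>

lemma pcas_append: "pcas u (p @ q) v \<longleftrightarrow> (\<exists>w. pcas u p w \<and> pcas w q v)"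
  by (induction p arbitrary: u) auto

lemma pcas_snoc: "pcas u (p @ [e]) v \<longleftrightarrow> pcas u p (fst e) \<and> snd e = v"
  by (cases e) (auto simp: pcas_append)

lemma last_pawalk_verts: "pcas u p v \<Longrightarrow> v \<in> set (pawalk_verts u p)"
  by (induction p arbitrary: u) auto

lemma pawalk_verts_append:
  "pcas u p v \<Longrightarrow> pcas v q w \<Longrightarrow> v \<in> set (pawalk_verts u (p @ q))"
  by (induction p arbitrary: u) (cases q, auto)

lemma pcas_rtrancl: "pcas u p v \<Longrightarrow> set p \<subseteq> E \<Longrightarrow> (u, v) \<in> E\<^sup>*"
  by (induction p arbitrary: u) (auto intro: converse_rtrancl_into_rtrancl)

lemma rtrancl_pcas: "(u, v) \<in> E\<^sup>* \<Longrightarrow> \<exists>p. pcas u p v \<and> set p \<subseteq> E"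
proof (induction rule: rtrancl_induct)
  case base
  show ?case by (rule exI[of _ "[]"]) simp
next
  case (step y z)
  then obtain p where "pcas u p y" "set p \<subseteq> E" by blast
  then show ?case using step(2) by (intro exI[of _ "p @ [(y, z)]"]) (auto simp: pcas_snoc)
qed

text \<open>A one-edge list may be a loop or a nontrivial edge. Separating the trivial path from
  nonempty walks in \<open>nontrivial G\<close> makes closure arguments applicable.\<close>

lemma dpath_iff:
  "dpath G u p v \<longleftrightarrow> u \<in> vertices G \<and>
     (p = [(v, v)] \<and> u = v \<and> (v, v) \<in> edges G \<or>
      p \<noteq> [] \<and> pcas u p v \<and> set p \<subseteq> nontrivial G)"
proof (cases "length p > 1")
  case True
  then show ?thesis
    by (auto simp: dpath_def pre_digraph.awalk_def cas_with_proj_eq nontrivial_def)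
next
  case False
  then consider "p = []" | e where "p = [e]"
    by (cases p) (auto simp: not_less)
  then show ?thesis
    by cases (auto simp: dpath_def pre_digraph.awalk_def cas_with_proj_eq nontrivial_def)
qed

lemma dpath_fst_hd: "dpath G u p v \<Longrightarrow> fst (hd p) = u"
  by (cases p) (auto simp: dpath_iff)

text \<open>Acyclicity is expressed by strictly increasing labels. Combined with reachability from
  \<open>r\<close>, this also excludes nontrivial edges into the root.\<close>

locale labeled_tree =
  fixes G :: "'v labeled_digraph" and r :: 'v
  assumes edges_vertices: "edges G \<subseteq> vertices G \<times> vertices G"
    and trivial_edge: "v \<in> vertices G \<Longrightarrow> (v, v) \<in> edges G"
    and label_less: "(u, v) \<in> nontrivial G \<Longrightarrow> vlab G u < vlab G v"
    and unique_source: "(u, v) \<in> nontrivial G \<Longrightarrow> (u', v) \<in> nontrivial G \<Longrightarrow> u = u'"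
    and root_vertex: "r \<in> vertices G"
    and reachable: "v \<in> vertices G \<Longrightarrow> (r, v) \<in> (nontrivial G)\<^sup>*"
begin

lemma rtrancl_vertex:
  assumes "(u, v) \<in> (nontrivial G)\<^sup>*" "v \<in> vertices G"
  shows "u \<in> vertices G"
  using assms edges_vertices
  by (cases rule: converse_rtranclE) (auto simp: nontrivial_def)

lemma rtrancl_label_le: "(u, v) \<in> (nontrivial G)\<^sup>* \<Longrightarrow> vlab G u \<le> vlab G v"
  by (induction rule: rtrancl_induct) (auto dest: label_less)

text \<open>Read backwards from \<open>v\<close>, the two walks agree by
  \<open>unique_source\<close>. If one ended earlier, its start would be a later vertex of the other
  walk and have a larger label.\<close>

lemma walk_unique:
  assumes "pcas u p v" "pcas u' p' v" "set p \<subseteq> nontrivial G" "set p' \<subseteq> nontrivial G"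
    and "vlab G u = vlab G u'"
  shows "u = u' \<and> p = p'"
  using assms
proof (induction p arbitrary: v p' rule: rev_induct)
  case Nil
  show ?case
  proof (cases p' rule: rev_cases)
    case (snoc q e)
    with Nil have "pcas u' q (fst e)" "set q \<subseteq> nontrivial G" "(fst e, v) \<in> nontrivial G"
      by (cases e, auto simp: pcas_snoc)+
    then have "vlab G u' < vlab G v"
      using rtrancl_label_le[OF pcas_rtrancl] label_less by fastforce
    with Nil show ?thesis by simp
  qed (use Nil in auto)
next
  case (snoc e p)
  have e: "pcas u p (fst e)" "set p \<subseteq> nontrivial G" "(fst e, v) \<in> nontrivial G" "snd e = v"
    using snoc.prems by (cases e, auto simp: pcas_snoc)+
  show ?case
  proof (cases p' rule: rev_cases)
    case Nil
    have "vlab G u < vlab G v"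
      using rtrancl_label_le[OF pcas_rtrancl] label_less e by fastforce
    with snoc.prems Nil show ?thesis by simp
  next
    case (snoc q e')
    have e': "pcas u' q (fst e')" "set q \<subseteq> nontrivial G" "(fst e', v) \<in> nontrivial G" "snd e' = v"
      using snoc.prems snoc by (cases e', auto simp: pcas_snoc)+
    have "fst e = fst e'"
      using unique_source e e' by blast
    then have "e = e'" using e e' by (simp add: prod_eq_iff)
    moreover have "u = u' \<and> p = q"
      using snoc.IH[of "fst e" q] e e' \<open>fst e = fst e'\<close> snoc.prems by simp
    ultimately show ?thesis using snoc by simp
  qed
qed

lemma nonempty_walk_label_less:
  assumes "p \<noteq> []" "pcas u p v" "set p \<subseteq> nontrivial G"
  shows "vlab G u < vlab G v"
proof -
  \<comment> \<open>Comparison with the empty walk at \<open>v\<close>.\<close>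
  have "v = u \<and> p = []" if "vlab G u = vlab G v"
    using walk_unique[of u p v v "[]"] assms that by simp
  then show ?thesis
    using assms rtrancl_label_le[OF pcas_rtrancl[OF assms(2,3)]] by linarith
qed

text \<open>A trivial path and a nonempty nontrivial walk to \<open>v\<close> cannot start at equal
  labels, so \<open>walk_unique\<close> covers the remaining case. Hence a label and a terminal
  vertex determine an attaching path.\<close>

lemma dpath_unique:
  assumes "dpath G u p v" "dpath G u' p' v" "vlab G u = vlab G u'"
  shows "u = u' \<and> p = p'"
  using assms walk_unique[of u p v u' p'] nonempty_walk_label_less[of p u v]
    nonempty_walk_label_less[of p' u' v]
  unfolding dpath_iff by fastforce

lemma ex_dpath_iff:
  assumes "v \<in> vertices G"
  shows "(\<exists>p. dpath G u p v) \<longleftrightarrow> (u, v) \<in> (nontrivial G)\<^sup>*"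
proof
  assume "\<exists>p. dpath G u p v"
  then show "(u, v) \<in> (nontrivial G)\<^sup>*"
    unfolding dpath_iff by (metis pcas_rtrancl rtrancl.rtrancl_refl)
next
  assume *: "(u, v) \<in> (nontrivial G)\<^sup>*"
  obtain p where p: "pcas u p v" "set p \<subseteq> nontrivial G"
    using rtrancl_pcas[OF *] by blast
  have "u \<in> vertices G" by (rule rtrancl_vertex[OF * assms])
  then have "dpath G u (if p = [] then [(v, v)] else p) v"
    using p trivial_edge[OF assms] by (auto simp: dpath_iff)
  then show "\<exists>p. dpath G u p v" by blast
qed

text \<open>Prepending a walk from the root to \<open>u\<close> gives the root path that
  \<open>attaching_path\<close> asks for.\<close>

lemma dpath_on_root_path:
  assumes "dpath G u q v"
  shows "\<exists>p. dpath G r p v \<and> u \<in> set (pawalk_verts r p)"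
proof -
  have "u \<in> vertices G" using assms by (simp add: dpath_iff)
  then obtain s where s: "pcas r s u" "set s \<subseteq> nontrivial G"
    using rtrancl_pcas[OF reachable] by blast
  consider "q = [(v, v)]" "u = v" "(v, v) \<in> edges G"
    | "q \<noteq> []" "pcas u q v" "set q \<subseteq> nontrivial G"
    using assms by (auto simp: dpath_iff)
  then show ?thesis
  proof cases
    case 1
    \<comment> \<open>The trivial edge cannot be appended to a nonempty walk, so \<open>s\<close>
      alone is the path unless it is empty.\<close>
    show ?thesis
    proof (cases "s = []")
      case True
      with s 1 root_vertex have "dpath G r q v" "u \<in> set (pawalk_verts r q)"
        by (auto simp: dpath_iff)
      then show ?thesis by blast
    next
      case False
      with s 1 root_vertex last_pawalk_verts[of r s u]
      have "dpath G r s v" "u \<in> set (pawalk_verts r s)"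
        by (auto simp: dpath_iff)
      then show ?thesis by blast
    qed
  next
    case 2
    have "dpath G r (s @ q) v"
      using s 2 root_vertex by (auto simp: dpath_iff pcas_append)
    with pawalk_verts_append[OF s(1) 2(2)] show ?thesis by blast
  qed
qed

text \<open>The ancestors of a vertex form a chain. In the induction along the path from
  \<open>u\<close>, the label bound keeps \<open>w\<close> different from the new end
  \<open>z\<close>, so the path from \<open>w\<close> also enters \<open>z\<close> through its only
  parent \<open>y\<close>.\<close>

lemma ancestor_of_ancestor:
  assumes "(u, v) \<in> (nontrivial G)\<^sup>*" "(w, v) \<in> (nontrivial G)\<^sup>*" "vlab G w \<le> vlab G u"
  shows "(w, u) \<in> (nontrivial G)\<^sup>*"
  using assms
proof (induction rule: rtrancl_induct)
  case (step y z)
  have "vlab G u < vlab G z"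
    using rtrancl_label_le[OF step.hyps(1)] label_less[OF step.hyps(2)] by simp
  then have "w \<noteq> z" using step.prems by auto
  then obtain y' where "(w, y') \<in> (nontrivial G)\<^sup>*" "(y', z) \<in> nontrivial G"
    using step.prems by (meson rtranclE)
  with unique_source step show ?case by blast
qed

lemma ancestor_labels_ancestor:
  assumes "(u, v) \<in> (nontrivial G)\<^sup>*"
  shows "ancestor_labels G u = {l \<in> ancestor_labels G v. l \<le> vlab G u}"
  using assms ancestor_of_ancestor[OF assms] rtrancl_label_le
  by (auto simp: ancestor_labels_def intro: rtrancl_trans)

lemma valence_childless:
  assumes "v \<in> vertices G" "v \<noteq> r" "\<And>w. (v, w) \<notin> nontrivial G"
  shows "valence G v = 1"
proof -
  obtain u where u: "(u, v) \<in> nontrivial G"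
    using reachable[OF assms(1)] assms(2) by (metis rtranclE)
  have "{e \<in> edges G. fst e \<noteq> snd e \<and> (fst e = v \<or> snd e = v)} =
      {e \<in> nontrivial G. fst e = v \<or> snd e = v}"
    by (auto simp: nontrivial_def)
  also have "\<dots> = {(u, v)}"
    using u assms(3) unique_source by fastforce
  finally have "{e \<in> edges G. fst e \<noteq> snd e \<and> (fst e = v \<or> snd e = v)} = {(u, v)}" .
  then show ?thesis by (simp add: valence_def)
qed

lemma valence_with_child:
  assumes "v \<in> vertices G" "v \<noteq> r" "(v, w) \<in> nontrivial G"
  shows "valence G v \<noteq> 1"
proof
  obtain u where u: "(u, v) \<in> nontrivial G"
    using reachable[OF assms(1)] assms(2) by (metis rtranclE)
  assume "valence G v = 1"
  then obtain x where x: "{e \<in> edges G. fst e \<noteq> snd e \<and> (fst e = v \<or> snd e = v)} = {x}"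
    by (auto simp: valence_def card_1_singleton_iff)
  \<comment> \<open>If the parent edge and the child edge coincided, then
    \<open>u = v\<close>.\<close>
  have "(u, v) \<in> {x}" "(v, w) \<in> {x}"
    unfolding x[symmetric] using u assms(3) by (auto simp: nontrivial_def)
  then show False using u by (auto simp: nontrivial_def)
qed

end

section \<open>Action graphs\<close>

declare action_graph.simps(2) [simp del]

text \<open>The leaves, described by label instead of valence; \<open>leaves_eq_top_vertices\<close>
  identifies the two.\<close>

definition top_vertices :: "nat \<Rightarrow> nat \<Rightarrow> vertex set" where
  "top_vertices k n = {v \<in> vertices (action_graph k n). vlab (action_graph k n) v = int n}"

lemma vertices_Suc:
  "vertices (action_graph k (Suc n)) =
     vertices (action_graph k n) \<union> Adj ` paths_to_label (action_graph k n) n"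
  by (simp add: action_graph.simps adjoin_def Let_def)

lemma vlab_Suc_old:
  "v \<in> vertices (action_graph k n) \<Longrightarrow>
     vlab (action_graph k (Suc n)) v = vlab (action_graph k n) v"
  using adjoined_vertices_new[of k n] by (auto simp: action_graph.simps adjoin_def Let_def)

lemma vlab_Suc_new:
  "p \<in> paths_to_label (action_graph k n) n \<Longrightarrow>
     vlab (action_graph k (Suc n)) (Adj p) = int n + 1"
  by (auto simp: action_graph.simps adjoin_def Let_def)

lemma paths_to_label_source:
  "p \<in> paths_to_label (action_graph k n) n \<Longrightarrow> fst (hd p) \<in> vertices (action_graph k n)"
  by (auto simp: paths_to_label_def dpath_fst_hd) (simp add: dpath_iff)

text \<open>A new edge is never a loop, because its source is an old vertex and its target is
  fresh.\<close>

lemma nontrivial_Suc: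
  "nontrivial (action_graph k (Suc n)) =
     nontrivial (action_graph k n) \<union>
     {(fst (hd p), Adj p) | p. p \<in> paths_to_label (action_graph k n) n}"
  using adjoined_vertices_new[of k n] paths_to_label_source[of _ k n]
  by (fastforce simp: nontrivial_def action_graph.simps adjoin_def Let_def)

text \<open>The label bound is carried through the induction so that the label \<open>n + 1\<close>
  exceeds that of every source of a new edge.\<close>

lemma action_graph_labeled_tree:
  "labeled_tree (action_graph k n) (action_root k) \<and>
   (\<forall>v \<in> vertices (action_graph k n). vlab (action_graph k n) v \<le> int n)"
proof (induction n)
  case 0
  have nt: "nontrivial (initial_graph k) = {(Base i, Base (i + 1)) | i. - int k \<le> i \<and> i < 0}"
    by (auto simp: nontrivial_def initial_graph_def Let_def)
  have reach: "(Base (- int k), Base (int j - int k)) \<in> (nontrivial (initial_graph k))\<^sup>*"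
    if "j \<le> k" for j
    using that
  proof (induction j)
    case (Suc j)
    then have "(Base (int j - int k), Base (int (Suc j) - int k)) \<in> nontrivial (initial_graph k)"
      by (auto simp: nt)
    with Suc show ?case by (auto intro: rtrancl_into_rtrancl)
  qed simp
  have "(Base (- int k), Base i) \<in> (nontrivial (initial_graph k))\<^sup>*" if "- int k \<le> i" "i \<le> 0" for i
    using reach[of "nat (i + int k)"] that by simp
  then show ?case
    unfolding labeled_tree_def action_graph.simps nt
    by (auto simp: initial_graph_def Let_def action_root_def)
next
  case (Suc n)
  let ?G = "action_graph k n" and ?H = "action_graph k (Suc n)"
  let ?P = "paths_to_label ?G n"
  interpret G: labeled_tree ?G "action_root k" using Suc by blast
  have nt: "u \<in> vertices ?G \<and> v \<in> vertices ?G" if "(u, v) \<in> nontrivial ?G" for u v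
    using that G.edges_vertices by (auto simp: nontrivial_def)
  have le: "vlab ?G v \<le> int n" if "v \<in> vertices ?G" for v
    using that Suc by blast
  have new: "Adj p \<notin> vertices ?G" if "p \<in> ?P" for p
    using that adjoined_vertices_new[of k n] by auto
  have "labeled_tree ?H (action_root k)"
  proof
    show "edges ?H \<subseteq> vertices ?H \<times> vertices ?H"
      using G.edges_vertices paths_to_label_source[of _ k n]
      by (auto simp: action_graph.simps adjoin_def Let_def)
    show "(v, v) \<in> edges ?H" if "v \<in> vertices ?H" for v
      using that G.trivial_edge by (auto simp: action_graph.simps adjoin_def Let_def)
    show "vlab ?H u < vlab ?H v" if "(u, v) \<in> nontrivial ?H" for u v
      using that[unfolded nontrivial_Suc]
    proof
      assume uv: "(u, v) \<in> nontrivial ?G"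
      then show ?thesis using nt[OF uv] G.label_less[OF uv] by (simp only: vlab_Suc_old)
    next
      assume "(u, v) \<in> {(fst (hd p), Adj p) | p. p \<in> ?P}"
      then obtain p where p: "p \<in> ?P" "u = fst (hd p)" "v = Adj p" by blast
      then show ?thesis
        using vlab_Suc_new[OF p(1)] vlab_Suc_old[OF paths_to_label_source[OF p(1)]]
          le[OF paths_to_label_source[OF p(1)]] unfolding p(2,3) by linarith
    qed
    \<comment> \<open>An edge into an old vertex is old, and a new vertex \<open>Adj p\<close>
      receives only the edge determined by \<open>p\<close>.\<close>
    show "u = u'" if "(u, v) \<in> nontrivial ?H" "(u', v) \<in> nontrivial ?H" for u u' v
      using that nt new G.unique_source unfolding nontrivial_Suc by blast
    show "action_root k \<in> vertices ?H"
      using G.root_vertex vertices_Suc by blast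
    have mono: "(nontrivial ?G)\<^sup>* \<subseteq> (nontrivial ?H)\<^sup>*"
      unfolding nontrivial_Suc by (rule rtrancl_mono) blast
    show "(action_root k, v) \<in> (nontrivial ?H)\<^sup>*" if "v \<in> vertices ?H" for v
      using that[unfolded vertices_Suc]
    proof
      assume "v \<in> vertices ?G"
      then show ?thesis using G.reachable mono by blast
    next
      assume "v \<in> Adj ` ?P"
      then obtain p where p: "p \<in> ?P" "v = Adj p" by blast
      then have "(fst (hd p), v) \<in> nontrivial ?H" unfolding nontrivial_Suc by blast
      moreover have "(action_root k, fst (hd p)) \<in> (nontrivial ?H)\<^sup>*"
        using G.reachable[OF paths_to_label_source[OF p(1)]] mono by blast
      ultimately show ?thesis by (rule rtrancl_into_rtrancl[rotated])
    qed
  qed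
  moreover have "vlab ?H v \<le> int (Suc n)" if "v \<in> vertices ?H" for v
    using that[unfolded vertices_Suc]
  proof
    assume v: "v \<in> vertices ?G"
    then show ?thesis using le[OF v] vlab_Suc_old[OF v] by linarith
  next
    assume "v \<in> Adj ` ?P"
    then show ?thesis using vlab_Suc_new by fastforce
  qed
  ultimately show ?case by blast
qed

interpretation action_graph: labeled_tree "action_graph k n" "action_root k" for k n
  using action_graph_labeled_tree by blast

lemma action_graph_label_le:
  "v \<in> vertices (action_graph k n) \<Longrightarrow> vlab (action_graph k n) v \<le> int n"
  using action_graph_labeled_tree by blast

lemma top_vertices_Suc:
  "top_vertices k (Suc n) = Adj ` paths_to_label (action_graph k n) n"
proof -
  have "vlab (action_graph k (Suc n)) v \<noteq> int (Suc n)" if "v \<in> vertices (action_graph k n)" for v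
    using action_graph_label_le[OF that] vlab_Suc_old[OF that] by linarith
  then show ?thesis
    unfolding top_vertices_def vertices_Suc using vlab_Suc_new[of _ k n] by auto
qed

section \<open>Leaves are the vertices of largest label\<close>

lemma trivial_path_to_label:
  assumes "v \<in> top_vertices k n"
  shows "[(v, v)] \<in> paths_to_label (action_graph k n) n"
  using assms action_graph.trivial_edge[of v k n]
  by (auto simp: paths_to_label_def top_vertices_def dpath_iff)

text \<open>A vertex gets a child one stage after its label was the largest, from its trivial path;
  later stages keep that child.\<close>

lemma action_graph_child:
  assumes "v \<in> vertices (action_graph k n)" "vlab (action_graph k n) v < int n"
  shows "\<exists>w. (v, w) \<in> nontrivial (action_graph k n)"
  using assms
proof (induction n)
  case 0
  then obtain i where i: "v = Base i" "- int k \<le> i" "i < 0"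
    by (auto simp: initial_graph_def Let_def)
  then have "(v, Base (i + 1)) \<in> nontrivial (action_graph k 0)"
    by (auto simp: nontrivial_def initial_graph_def Let_def)
  then show ?case by blast
next
  case (Suc n)
  let ?G = "action_graph k n"
  have v: "v \<in> vertices ?G"
    using Suc.prems vlab_Suc_new[of _ k n] unfolding vertices_Suc by auto
  show ?case
  proof (cases "vlab ?G v < int n")
    case True
    then show ?thesis using Suc.IH v unfolding nontrivial_Suc by blast
  next
    case False
    then have "[(v, v)] \<in> paths_to_label ?G n"
      using v action_graph_label_le[OF v] by (intro trivial_path_to_label) (simp add: top_vertices_def)
    then have "(fst (hd [(v, v)]), Adj [(v, v)]) \<in> nontrivial (action_graph k (Suc n))"
      unfolding nontrivial_Suc by blast
    then show ?thesis by auto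
  qed
qed

lemma vlab_root: "vlab (action_graph k n) (action_root k) = - int k"
proof (induction n)
  case 0
  show ?case by (simp add: initial_graph_def Let_def action_root_def)
next
  case (Suc n)
  then show ?case using vlab_Suc_old[OF action_graph.root_vertex] by simp
qed

lemma leaves_eq_top_vertices: "leaves (action_graph k n) (action_root k) = top_vertices k n"
proof (intro equalityI subsetI)
  let ?G = "action_graph k n"
  fix v assume "v \<in> leaves ?G (action_root k)"
  then have v: "v \<in> vertices ?G"
    and alt: "v \<noteq> action_root k \<and> valence ?G v = 1 \<or> vertices ?G = {action_root k}"
    by (auto simp: leaves_def)
  have "\<not> vlab ?G v < int n"
  proof
    assume "vlab ?G v < int n"
    then obtain w where w: "(v, w) \<in> nontrivial ?G"
      using action_graph_child[OF v] by blast
    then have "w \<in> vertices ?G" "v \<noteq> w"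
      using action_graph.edges_vertices[of k n] by (auto simp: nontrivial_def)
    \<comment> \<open>The child \<open>w\<close> refutes both alternatives: it raises the valence
      above one, and it is a second vertex.\<close>
    with alt v action_graph.valence_with_child[OF v _ w] show False by auto
  qed
  then show "v \<in> top_vertices k n"
    using v action_graph_label_le[OF v] by (simp add: top_vertices_def)
next
  let ?G = "action_graph k n"
  fix v assume v: "v \<in> top_vertices k n"
  then have vG: "v \<in> vertices ?G" and lab: "vlab ?G v = int n"
    by (auto simp: top_vertices_def)
  show "v \<in> leaves ?G (action_root k)"
  proof (cases "v = action_root k")
    case True
    \<comment> \<open>The root has label \<open>- int k\<close>, which equals \<open>int n\<close>
      only if both are zero.\<close>
    then have "k = 0 \<and> n = 0" using lab vlab_root[of k n] by simp
    then have "vertices ?G = {action_root k}"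
      by (auto simp: initial_graph_def Let_def action_root_def)
    then show ?thesis using vG by (simp add: leaves_def)
  next
    case False
    have "(v, w) \<notin> nontrivial ?G" for w
    proof
      assume w: "(v, w) \<in> nontrivial ?G"
      then have "w \<in> vertices ?G"
        using action_graph.edges_vertices[of k n] by (auto simp: nontrivial_def)
      then show False
        using action_graph_label_le action_graph.label_less[OF w] lab by fastforce
    qed
    then show ?thesis
      using False vG action_graph.valence_childless[OF vG False] by (simp add: leaves_def)
  qed
qed

section \<open>Attaching paths and ancestor labels\<close>

lemma attaching_path_iff:
  "attaching_path k n v l q \<longleftrightarrow>
     (\<exists>u. dpath (action_graph k n) u q v \<and> vlab (action_graph k n) u = l)"
  using action_graph.dpath_on_root_path[of k n] unfolding attaching_path_def by blast

lemma ex1_attaching_path: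
  assumes "v \<in> vertices (action_graph k n)" "l \<in> ancestor_labels (action_graph k n) v"
  shows "\<exists>!q. attaching_path k n v l q"
proof (rule ex_ex1I)
  show "\<exists>q. attaching_path k n v l q"
    using assms(2) action_graph.ex_dpath_iff[OF assms(1)]
    unfolding attaching_path_iff ancestor_labels_def by blast
  show "q = q'" if "attaching_path k n v l q" "attaching_path k n v l q'" for q q'
    using that action_graph.dpath_unique unfolding attaching_path_iff by blast
qed

text \<open>The only nontrivial edge into \<open>Adj q\<close> comes from \<open>u\<close>, so its
  proper ancestors are those of \<open>u\<close> together with \<open>u\<close>. Their labels form
  an initial segment of the ancestor labels of \<open>v\<close>. The counterpart for forests is
  \<open>attach_positions_attach\<close>.\<close>

lemma ancestor_labels_adjoined:
  assumes q: "dpath (action_graph k n) u q v" and v: "v \<in> top_vertices k n"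
  shows "ancestor_labels (action_graph k (Suc n)) (Adj q) =
     insert (int n + 1) {l \<in> ancestor_labels (action_graph k n) v. l \<le> vlab (action_graph k n) u}"
proof -
  let ?G = "action_graph k n" and ?H = "action_graph k (Suc n)"
  have qP: "q \<in> paths_to_label ?G n"
    using q v by (auto simp: paths_to_label_def top_vertices_def)
  have u: "u \<in> vertices ?G" using q by (simp add: dpath_iff)
  have new: "Adj p \<notin> vertices ?G" if "p \<in> paths_to_label ?G n" for p
    using that adjoined_vertices_new[of k n] by auto
  have nt: "x \<in> vertices ?G \<and> y \<in> vertices ?G" if "(x, y) \<in> nontrivial ?G" for x y
    using that action_graph.edges_vertices[of k n] by (auto simp: nontrivial_def)
  have into_new: "(x, Adj q) \<in> nontrivial ?H \<longleftrightarrow> x = u" for x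
    using qP new[OF qP] nt dpath_fst_hd[OF q] unfolding nontrivial_Suc by blast
  \<comment> \<open>New edges end in new vertices, which have no children yet, so a path to an old
    vertex uses old edges only.\<close>
  have into_old: "(x, y) \<in> (nontrivial ?H)\<^sup>* \<Longrightarrow> y \<in> vertices ?G \<Longrightarrow>
    (x, y) \<in> (nontrivial ?G)\<^sup>*" for x y
  proof (induction rule: rtrancl_induct)
    case (step y z)
    then have yz: "(y, z) \<in> nontrivial ?G"
      using new unfolding nontrivial_Suc by blast
    then have "(x, y) \<in> (nontrivial ?G)\<^sup>*" using step.IH nt by blast
    then show ?case using yz by (rule rtrancl_into_rtrancl)
  qed simp
  have mono: "(nontrivial ?G)\<^sup>* \<subseteq> (nontrivial ?H)\<^sup>*"
    unfolding nontrivial_Suc by (rule rtrancl_mono) blast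
  have "{x. (x, Adj q) \<in> (nontrivial ?H)\<^sup>*} = insert (Adj q) {x. (x, u) \<in> (nontrivial ?G)\<^sup>*}"
    (is "?A = ?B")
  proof (intro equalityI subsetI)
    fix x assume "x \<in> ?A"
    then have "(x, Adj q) \<in> (nontrivial ?H)\<^sup>*" by simp
    then show "x \<in> ?B"
    proof (cases rule: rtranclE)
      case (step y)
      then have "(x, u) \<in> (nontrivial ?H)\<^sup>*" using into_new by simp
      then show ?thesis using into_old u by simp
    qed simp
  next
    fix x assume "x \<in> ?B"
    moreover have "(x, Adj q) \<in> (nontrivial ?H)\<^sup>*" if "(x, u) \<in> (nontrivial ?G)\<^sup>*"
    proof (rule rtrancl_into_rtrancl)
      show "(x, u) \<in> (nontrivial ?H)\<^sup>*" using that mono by blast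
      show "(u, Adj q) \<in> nontrivial ?H" using into_new by blast
    qed
    ultimately show "x \<in> ?A" by auto
  qed
  moreover have "vlab ?H x = vlab ?G x" if "(x, u) \<in> (nontrivial ?G)\<^sup>*" for x
    using vlab_Suc_old[OF action_graph.rtrancl_vertex[OF that u]] .
  ultimately have "ancestor_labels ?H (Adj q) = insert (int n + 1) (ancestor_labels ?G u)"
    unfolding ancestor_labels_def by (simp add: vlab_Suc_new[OF qP] cong: image_cong_simp)
  moreover have "(u, v) \<in> (nontrivial ?G)\<^sup>*"
    using action_graph.ex_dpath_iff[of v k n u] q v by (auto simp: top_vertices_def)
  ultimately show ?thesis
    using action_graph.ancestor_labels_ancestor by simp
qed

lemma ancestor_labels_initial: "ancestor_labels (action_graph k 0) (Base 0) = {- int k..0}"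
proof (intro equalityI subsetI)
  let ?G = "action_graph k 0"
  have lab: "vlab ?G (Base i) = i" for i by (simp add: initial_graph_def Let_def)
  have V: "vertices ?G = Base ` {- int k..0}" by (simp add: initial_graph_def Let_def)
  fix l
  {
    assume "l \<in> ancestor_labels ?G (Base 0)"
    then obtain u where u: "(u, Base 0) \<in> (nontrivial ?G)\<^sup>*" "l = vlab ?G u"
      by (auto simp: ancestor_labels_def)
    have "u \<in> vertices ?G" by (rule action_graph.rtrancl_vertex[OF u(1)]) (unfold V, simp)
    then show "l \<in> {- int k..0}" using u(2) V lab by auto
  next
    have reach: "(Base (- int j), Base 0) \<in> (nontrivial ?G)\<^sup>*" if "j \<le> k" for j
      using that
    proof (induction j)
      case (Suc j)
      then have "(Base (- int (Suc j)), Base (- int j)) \<in> nontrivial ?G"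
        by (auto simp: nontrivial_def initial_graph_def Let_def)
      with Suc show ?case by (meson Suc_leD converse_rtrancl_into_rtrancl)
    qed simp
    assume "l \<in> {- int k..0}"
    then have "(Base l, Base 0) \<in> (nontrivial ?G)\<^sup>*"
      using reach[of "nat (- l)"] by auto
    then show "l \<in> ancestor_labels ?G (Base 0)"
      unfolding ancestor_labels_def using lab by (metis image_eqI mem_Collect_eq)
  }
qed

section \<open>Attaching a new last vertex to a forest\<close>

text \<open>
  A vertex attached to a forest as a leftmost child comes last in the canonical order exactly
  if its parent is the last vertex, one of that vertex's ancestors, or a root further to the left.
  \<open>attach_positions F\<close> lists the positions of these parents in \<open>forest_vertices F\<close>, and
  \<open>attach_address j F\<close> is the address of the \<open>j\<close>-th of them.
\<close>

fun spine_positions :: "ptree \<Rightarrow> nat list" where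
  "spine_positions (Node []) = []"
| "spine_positions (Node (t # ts)) =
     num_edges (Node ts) # map ((+) (Suc (num_edges (Node ts)))) (spine_positions t)"

fun attach_positions :: "ptree list \<Rightarrow> nat list" where
  "attach_positions [] = []"
| "attach_positions (T # F) =
     0 # (if T = Node [] then map Suc (attach_positions F)
          else map ((+) (Suc (length (forest_vertices F)))) (spine_positions T))"

text \<open>Here \<open>j\<close> is the height of the new vertex's parent on the leftmost branch,
  with the root at height zero.\<close>

fun attach_tree :: "nat \<Rightarrow> ptree \<Rightarrow> ptree" where
  "attach_tree 0 T = Node (Node [] # subtrees T)"
| "attach_tree (Suc j) T = Node (attach_tree j (hd (subtrees T)) # tl (subtrees T))"

text \<open>The index \<open>j\<close> refers to \<open>attach_positions F\<close>: each leading
  one-vertex tree that is passed uses up one unit, and the rest is the height on the leftmost branch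
  of the tree reached.\<close>

fun attach :: "nat \<Rightarrow> ptree list \<Rightarrow> ptree list" where
  "attach j [] = []"
| "attach 0 (T # F) = attach_tree 0 T # F"
| "attach (Suc j) (T # F) =
     (if T = Node [] then T # attach j F else attach_tree (Suc j) T # F)"

text \<open>The change of addresses when one more tree or child is placed on the left.\<close>

fun shift_address :: "nat list \<Rightarrow> nat list" where
  "shift_address [] = []"
| "shift_address (i # w) = Suc i # w"

fun attach_address :: "nat \<Rightarrow> ptree list \<Rightarrow> nat list" where
  "attach_address j [] = []"
| "attach_address 0 (T # F) = [0]"
| "attach_address (Suc j) (T # F) =
     (if T = Node [] then shift_address (attach_address j F) else replicate (Suc (Suc j)) 0)"

section \<open>The canonical order, unfolded at the leftmost tree or child\<close>

lemma map2_upt_Suc: "map2 f [0..<Suc n] (x # xs) = f 0 x # map2 (\<lambda>i. f (Suc i)) [0..<n] xs"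
proof -
  have "[0..<Suc n] = 0 # map Suc [0..<n]"
    by (simp add: upt_conv_Cons map_Suc_upt del: upt_Suc)
  moreover have "map2 f (map Suc is) xs = map2 (\<lambda>i. f (Suc i)) is xs" for "is"
    by (simp add: zip_map1 case_prod_unfold comp_def)
  ultimately show ?thesis by simp
qed

lemma descendants_Cons:
  "descendants (Node (t # ts)) =
     map shift_address (descendants (Node ts)) @ [0] # map ((#) 0) (descendants t)"
  unfolding descendants.simps list.map list.size(4) add_Suc_right add_0_right map2_upt_Suc
  by (simp add: map_concat rev_map comp_def case_prod_unfold)

lemma forest_nonroots_Cons:
  "forest_nonroots (T # F) =
     map shift_address (forest_nonroots F) @ map ((#) 0) (descendants T)"
  unfolding forest_nonroots_def list.size(4) add_Suc_right add_0_right map2_upt_Suc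
  by (simp add: map_concat rev_map comp_def case_prod_unfold)

lemma forest_vertices_Nil: "forest_vertices [] = []"
  by (simp add: forest_vertices_def forest_roots_def forest_nonroots_def)

lemma forest_vertices_Cons:
  "forest_vertices (T # F) =
     [0] # map shift_address (forest_vertices F) @ map ((#) 0) (descendants T)"
proof -
  have "forest_roots (T # F) = [0] # map shift_address (forest_roots F)"
    by (simp add: forest_roots_def upt_conv_Cons comp_def map_Suc_upt[symmetric] del: upt_Suc)
  then show ?thesis by (simp add: forest_vertices_def forest_nonroots_Cons)
qed

text \<open>Splitting off the leftmost child matches the recursion of \<open>spine_positions\<close>
  and follows the leftmost branch.\<close>

lemma ptree_induct:
  assumes "P (Node [])" "\<And>t ts. P t \<Longrightarrow> P (Node ts) \<Longrightarrow> P (Node (t # ts))"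
  shows "P T"
proof (induction T rule: measure_induct_rule[of size])
  case (less T)
  then show ?case
    using assms by (cases T; cases "subtrees T") auto
qed

lemma num_edges_Cons: "num_edges (Node (t # ts)) = Suc (num_edges t + num_edges (Node ts))"
  by simp

lemma length_descendants: "length (descendants T) = num_edges T"
  by (induction T rule: ptree_induct)
    (simp_all only: descendants_Cons num_edges_Cons, simp_all)

lemma length_forest_vertices:
  "length (forest_vertices F) = length F + sum_list (map num_edges F)"
  by (induction F) (simp_all add: forest_vertices_Nil forest_vertices_Cons length_descendants)

lemma shift_address_eq_Nil [simp]: "shift_address w = [] \<longleftrightarrow> w = []"
  by (cases w) auto

lemma Nil_in_shift_address: "[] \<in> shift_address ` A \<longleftrightarrow> [] \<in> A"
  unfolding image_iff by (metis shift_address_eq_Nil)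

lemma inj_shift_address: "inj shift_address"
proof (rule injI)
  fix v w assume "shift_address v = shift_address w"
  then show "v = w" by (cases v; cases w) auto
qed

lemma descendants_nonempty: "[] \<notin> set (descendants T)"
proof (induction T rule: ptree_induct)
  case (2 t ts)
  then show ?case
    unfolding descendants_Cons set_append set_map Un_iff Nil_in_shift_address by auto
qed simp

lemma forest_vertices_nonempty: "[] \<notin> set (forest_vertices F)"
proof (induction F)
  case (Cons T F)
  then show ?case by (auto simp: forest_vertices_Cons Nil_in_shift_address)
qed (simp add: forest_vertices_Nil)

lemma shift_address_neq: "w \<noteq> [] \<Longrightarrow> shift_address w \<noteq> 0 # v"
  by (cases w) auto

lemma distinct_descendants: "distinct (descendants T)"
proof (induction T rule: ptree_induct)
  case (2 t ts)
  then show ?case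
    using descendants_nonempty[of "Node ts"] descendants_nonempty[of t] shift_address_neq
    by (auto simp: descendants_Cons distinct_map inj_on_subset[OF inj_shift_address]
        simp del: descendants.simps) metis+
qed simp

lemma distinct_forest_vertices: "distinct (forest_vertices F)"
proof (induction F)
  case (Cons T F)
  then show ?case
    using descendants_nonempty[of T] forest_vertices_nonempty[of F] shift_address_neq
      distinct_descendants[of T]
    by (auto simp: forest_vertices_Cons distinct_map inj_on_subset[OF inj_shift_address]) metis+
qed (simp add: forest_vertices_Nil)

text \<open>Distinct addresses make the definite description determinate.\<close>

lemma canonical_label_nth:
  assumes "i < length (forest_vertices F)"
  shows "canonical_label k F (forest_vertices F ! i) = int i - int k"
  unfolding canonical_label_def
  using assms distinct_forest_vertices[of F] by (auto simp: nth_eq_iff_index_eq)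

lemma vertex_labeled_nth:
  assumes "i < length (forest_vertices F)"
  shows "vertex_labeled k F (int i - int k) = forest_vertices F ! i"
  unfolding vertex_labeled_def
proof (rule the_equality)
  show "forest_vertices F ! i \<in> set (forest_vertices F) \<and>
      canonical_label k F (forest_vertices F ! i) = int i - int k"
    using assms by (simp add: canonical_label_nth)
  show "w = forest_vertices F ! i"
    if "w \<in> set (forest_vertices F) \<and> canonical_label k F w = int i - int k" for w
    using that by (auto simp: in_set_conv_nth canonical_label_nth)
qed

text \<open>The new vertex ends the leftmost branch, cutting off what lay above its parent. Being
  last in the order, it leaves earlier positions unchanged.\<close>

lemma spine_positions_attach_tree:
  "j \<le> length (spine_positions T) \<Longrightarrow>
     spine_positions (attach_tree j T) = take j (spine_positions T) @ [num_edges T]"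
proof (induction T arbitrary: j rule: ptree_induct)
  case 1
  then show ?case by simp
next
  case (2 t ts)
  then show ?case by (cases j) (auto simp: take_map)
qed

lemma attach_tree_neq: "attach_tree j T \<noteq> Node []"
  by (cases j) auto

text \<open>The forest half of the common recursion: candidates up to the chosen parent survive, and
  the new last vertex joins them.\<close>

lemma attach_positions_attach:
  "j < length (attach_positions F) \<Longrightarrow>
     attach_positions (attach j F) = take (Suc j) (attach_positions F) @ [length (forest_vertices F)]"
proof (induction F arbitrary: j)
  case (Cons T F)
  show ?case
  proof (cases j)
    case 0
    then show ?thesis
      using spine_positions_attach_tree[of 0 T] attach_tree_neq[of 0 T]
      by (simp add: forest_vertices_Cons length_descendants del: attach_tree.simps)
  next
    case (Suc i)
    show ?thesis
    proof (cases "T = Node []")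
      case True
      with Suc Cons show ?thesis by (simp add: take_map forest_vertices_Cons)
    next
      case False
      then have "spine_positions (attach_tree j T) = take j (spine_positions T) @ [num_edges T]"
        using Suc Cons.prems by (intro spine_positions_attach_tree) auto
      with False Suc show ?thesis
        using attach_tree_neq[of j T]
        by (simp add: take_map forest_vertices_Cons length_descendants del: attach_tree.simps)
    qed
  qed
qed simp

section \<open>Edge count, address and deletion of the attached vertex\<close>

lemma length_attach [simp]: "length (attach j F) = length F"
  by (induction j F rule: attach.induct) auto

lemma num_edges_attach_tree:
  "j \<le> length (spine_positions T) \<Longrightarrow> num_edges (attach_tree j T) = Suc (num_edges T)"
proof (induction T arbitrary: j rule: ptree_induct)
  case 1
  then show ?case by simp
next
  case (2 t ts)
  then show ?case by (cases j) auto
qed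

lemma num_edges_attach:
  "j < length (attach_positions F) \<Longrightarrow>
     sum_list (map num_edges (attach j F)) = Suc (sum_list (map num_edges F))"
proof (induction j F rule: attach.induct)
  case (3 j T F)
  then show ?case
    using num_edges_attach_tree[of "Suc j" T] by (auto simp del: attach_tree.simps)
qed (auto simp: num_edges_attach_tree simp del: attach_tree.simps)

lemma last_descendants_attach_tree:
  "descendants (attach_tree j T) \<noteq> [] \<and> last (descendants (attach_tree j T)) = replicate (Suc j) 0"
  by (induction j T rule: attach_tree.induct)
    (simp_all add: descendants_Cons last_map del: descendants.simps, simp)

lemma attach_address_nonempty: "F \<noteq> [] \<Longrightarrow> j < length (attach_positions F) \<Longrightarrow> attach_address j F \<noteq> []"
proof (induction j F rule: attach_address.induct)
  case (3 j T F)
  then show ?case by (cases F; cases "attach_address j F") auto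
qed auto

lemma shift_address_append: "v \<noteq> [] \<Longrightarrow> shift_address (v @ w) = shift_address v @ w"
  by (cases v) auto

text \<open>This justifies the choice of candidate parents: the new leftmost child, with final index
  0, receives the largest label.\<close>

lemma last_forest_vertices_attach:
  "j < length (attach_positions F) \<Longrightarrow> last (forest_vertices (attach j F)) = attach_address j F @ [0]"
proof (induction j F rule: attach_address.induct)
  case (2 T F)
  then show ?case
    using last_descendants_attach_tree[of 0 T]
    by (simp add: forest_vertices_Cons last_map del: attach_tree.simps)
next
  case (3 j T F)
  show ?case
  proof (cases "T = Node []")
    case True
    then have j: "j < length (attach_positions F)" using 3 by simp
    then have "F \<noteq> []" by auto
    moreover from this have "forest_vertices (attach j F) \<noteq> []"
      using length_forest_vertices[of "attach j F"] by auto
    ultimately show ?thesis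
      using True 3 j attach_address_nonempty[of F j]
      by (simp add: forest_vertices_Cons last_map shift_address_append)
  next
    case False
    then show ?thesis
      using last_descendants_attach_tree[of "Suc j" T]
      by (simp add: forest_vertices_Cons last_map replicate_append_same del: attach_tree.simps)
  qed
qed auto

lemma descendants_nth_spine:
  "j < length (spine_positions T) \<Longrightarrow> spine_positions T ! j < num_edges T \<and>
     descendants T ! (spine_positions T ! j) = replicate (Suc j) 0"
proof (induction T arbitrary: j rule: ptree_induct)
  case (2 t ts)
  then show ?case
    by (cases j)
      (auto simp: descendants_Cons nth_append length_descendants simp del: descendants.simps num_edges.simps,
        auto)
qed simp

lemma forest_vertices_nth_attach:
  "j < length (attach_positions F) \<Longrightarrow> attach_positions F ! j < length (forest_vertices F) \<and>
     forest_vertices F ! (attach_positions F ! j) = attach_address j F"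
proof (induction j F rule: attach_address.induct)
  case (3 j T F)
  then show ?case
    using descendants_nth_spine[of j T]
    by (auto simp: forest_vertices_Cons nth_append length_descendants)
qed (auto simp: forest_vertices_Cons)

text \<open>A new leftmost child shifts indices only above its parent, so the parent keeps its
  address.\<close>

lemma attach_address_attach:
  "j < length (attach_positions F) \<Longrightarrow> attach_address j (attach j F) = attach_address j F"
  by (induction j F rule: attach_address.induct) auto

lemma delete_vertex_shift_address:
  "w \<noteq> [] \<Longrightarrow> delete_vertex (shift_address w) (T # F) = T # delete_vertex w F"
  by (cases "(w, F)" rule: delete_vertex.cases) auto

lemma delete_vertex_attach_tree:
  "j \<le> length (spine_positions T) \<Longrightarrow>
     delete_vertex (replicate (Suc j) 0) (subtrees (attach_tree j T)) = subtrees T"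
proof (induction T arbitrary: j rule: ptree_induct)
  case 1
  then show ?case by simp
next
  case (2 t ts)
  then show ?case by (cases j) auto
qed

lemma delete_vertex_attach:
  "j < length (attach_positions F) \<Longrightarrow> delete_vertex (attach_address j F @ [0]) (attach j F) = F"
proof (induction j F rule: attach_address.induct)
  case (3 j T F)
  show ?case
  proof (cases "T = Node []")
    case True
    then have j: "j < length (attach_positions F)" using 3 by simp
    then have "F \<noteq> []" by auto
    then have ne: "attach_address j F \<noteq> []" by (rule attach_address_nonempty[OF _ j])
    have "shift_address (attach_address j F) @ [0] = shift_address (attach_address j F @ [0])"
      using ne by (simp add: shift_address_append)
    then show ?thesis
      using True 3 j by (simp add: delete_vertex_shift_address)
  next
    case False
    then show ?thesis
      using 3 delete_vertex_attach_tree[of "Suc j" T]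
      by (simp add: replicate_append_same del: attach_tree.simps)
  qed
qed auto

text \<open>Climbing the leftmost branch until the leftmost child is childless finds the vertex to
  remove.\<close>

lemma attach_tree_surj:
  "num_edges T > 0 \<Longrightarrow> \<exists>j T'. j \<le> length (spine_positions T') \<and> T = attach_tree j T'"
proof (induction T rule: ptree_induct)
  case (2 t ts)
  show ?case
  proof (cases "num_edges t = 0")
    case True
    then have "t = Node []" by (cases t) auto
    then have "Node (t # ts) = attach_tree 0 (Node ts)" by simp
    then show ?thesis by blast
  next
    case False
    then obtain j T' where "j \<le> length (spine_positions T')" "t = attach_tree j T'"
      using 2 by auto
    then have "Suc j \<le> length (spine_positions (Node (T' # ts)))"
      "Node (t # ts) = attach_tree (Suc j) (Node (T' # ts))"
      by simp_all
    then show ?thesis by blast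
  qed
qed simp

lemma attach_surj:
  "sum_list (map num_edges F) > 0 \<Longrightarrow> \<exists>j F'. j < length (attach_positions F') \<and> F = attach j F'"
proof (induction F)
  case (Cons T F)
  show ?case
  proof (cases "num_edges T = 0")
    case True
    then obtain j F' where j: "j < length (attach_positions F')" "F = attach j F'"
      using Cons by auto
    moreover have "T = Node []" using True by (cases T) auto
    ultimately have "Suc j < length (attach_positions (T # F'))" "T # F = attach (Suc j) (T # F')"
      by auto
    then show ?thesis by blast
  next
    case False
    then obtain j T' where j: "j \<le> length (spine_positions T')" "T = attach_tree j T'"
      using attach_tree_surj by blast
    \<comment> \<open>If \<open>T'\<close> is a single vertex, then \<open>j = 0\<close>, so
      \<open>attach\<close> acts on \<open>T'\<close> itself in every case.\<close>
    then have "j < length (attach_positions (T' # F)) \<and> T # F = attach j (T' # F)"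
      by (cases j; cases "T' = Node []") auto
    then show ?thesis by blast
  qed
qed simp

lemma sorted_spine_positions: "sorted_wrt (<) (spine_positions T)"
  by (induction T rule: ptree_induct) (auto simp: sorted_wrt_map)

text \<open>Strict increase makes \<open>j\<close> recoverable from its position and turns position
  bounds into prefixes.\<close>

lemma sorted_attach_positions: "sorted_wrt (<) (attach_positions F)"
  by (induction F) (auto simp: sorted_wrt_map sorted_spine_positions)

lemma planar_forests_0: "planar_forests k 0 = {replicate (Suc k) (Node [])}"
proof -
  have *: "num_edges T = 0 \<longleftrightarrow> T = Node []" for T by (cases T) auto
  have "F \<in> planar_forests k 0 \<longleftrightarrow> length F = Suc k \<and> (\<forall>T \<in> set F. T = Node [])" for F
    by (simp add: planar_forests_def *)
  also have "\<dots> F \<longleftrightarrow> F = replicate (Suc k) (Node [])" for F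
    by (metis in_set_replicate length_replicate replicate_eqI)
  finally show ?thesis by blast
qed

lemma attach_positions_0: "attach_positions (replicate m (Node [])) = [0..<m]"
proof (induction m)
  case (Suc m)
  then show ?case by (simp add: upt_conv_Cons map_Suc_upt del: upt_Suc)
qed simp

text \<open>Inductive generation of forests: \<open>attach_surj\<close> gives the decomposition, and
  the edge count places the smaller forest.\<close>

lemma planar_forests_Suc:
  "planar_forests k (Suc n) =
     {attach j F | j F. F \<in> planar_forests k n \<and> j < length (attach_positions F)}"
proof (intro equalityI subsetI)
  fix F assume F: "F \<in> planar_forests k (Suc n)"
  then obtain j F' where "j < length (attach_positions F')" "F = attach j F'"
    using attach_surj[of F] by (auto simp: planar_forests_def)
  then show "F \<in> {attach j F | j F. F \<in> planar_forests k n \<and> j < length (attach_positions F)}"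
    using F num_edges_attach[of j F'] by (auto simp: planar_forests_def)
qed (auto simp: planar_forests_def num_edges_attach)

lemma vertex_labeled_attach:
  assumes "F \<in> planar_forests k n" "j < length (attach_positions F)"
  shows "vertex_labeled k (attach j F) (int n + 1) = attach_address j F @ [0]"
proof -
  have len: "length (forest_vertices (attach j F)) = Suc (Suc (k + n))"
    using assms by (simp add: length_forest_vertices num_edges_attach planar_forests_def)
  \<comment> \<open>Among the \<open>k + n + 2\<close> vertices, counted from position 0 with label
    \<open>- k\<close>, the last has label \<open>n + 1\<close>.\<close>
  have "vertex_labeled k (attach j F) (int (Suc (k + n)) - int k) =
      forest_vertices (attach j F) ! Suc (k + n)"
    by (rule vertex_labeled_nth) (simp add: len)
  also have "\<dots> = last (forest_vertices (attach j F))"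
    using len by (simp add: last_conv_nth flip: length_greater_0_conv)
  also have "\<dots> = attach_address j F @ [0]"
    by (rule last_forest_vertices_attach[OF assms(2)])
  also have "int (Suc (k + n)) - int k = int n + 1" by simp
  finally show ?thesis .
qed

lemma truncate_forest_attach:
  assumes "F \<in> planar_forests k n" "j < length (attach_positions F)"
  shows "truncate_forest k n (attach j F) = F"
  by (simp add: truncate_forest_def vertex_labeled_attach[OF assms] delete_vertex_attach[OF assms(2)])

lemma parent_label_attach:
  assumes "F \<in> planar_forests k n" "j < length (attach_positions F)"
  shows "parent_label k n (attach j F) = int (attach_positions F ! j) - int k"
proof -
  let ?F = "attach j F"
  \<comment> \<open>The parent label is read in the enlarged forest, where the first
    \<open>Suc j\<close> candidate positions are unchanged.\<close>
  have j: "j < length (attach_positions ?F)" "attach_positions ?F ! j = attach_positions F ! j"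
    using assms(2) by (simp_all add: attach_positions_attach nth_append)
  have "attach_address j F = forest_vertices ?F ! (attach_positions F ! j)"
    and "attach_positions F ! j < length (forest_vertices ?F)"
    using forest_vertices_nth_attach[OF j(1)] attach_address_attach[OF assms(2)] j(2) by simp_all
  then show ?thesis
    by (simp only: parent_label_def vertex_labeled_attach[OF assms] canonical_label_nth butlast_snoc)
qed

section \<open>The assembly procedure\<close>

text \<open>
  The statement about ancestor labels is what makes the induction go through: by it, the choices
  for attaching a vertex to \<open>F\<close> are the choices for a path ending in \<open>assembly k n F\<close>.
\<close>

lemma
  assumes F: "F \<in> planar_forests k n" and j: "j < length (attach_positions F)"
    and top: "assembly k n F \<in> top_vertices k n"
    and anc: "ancestor_labels (action_graph k n) (assembly k n F) =
      (\<lambda>i. int i - int k) ` set (attach_positions F)"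
  shows ex1_attaching_path_assembly:
      "\<exists>!q. attaching_path k n (assembly k n (truncate_forest k n (attach j F)))
        (parent_label k n (attach j F)) q"
    and assembly_attach:
      "\<exists>u q. assembly k (Suc n) (attach j F) = Adj q \<and>
        dpath (action_graph k n) u q (assembly k n F) \<and>
        vlab (action_graph k n) u = int (attach_positions F ! j) - int k"
proof -
  let ?l = "int (attach_positions F ! j) - int k"
  have "?l \<in> ancestor_labels (action_graph k n) (assembly k n F)"
    using j by (auto simp: anc)
  then have ex1: "\<exists>!q. attaching_path k n (assembly k n F) ?l q"
    using top by (intro ex1_attaching_path) (simp_all add: top_vertices_def)
  then show "\<exists>!q. attaching_path k n (assembly k n (truncate_forest k n (attach j F)))
        (parent_label k n (attach j F)) q"
    by (simp only: truncate_forest_attach[OF F j] parent_label_attach[OF F j])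
  have "attaching_path k n (assembly k n F) ?l (THE q. attaching_path k n (assembly k n F) ?l q)"
    by (rule theI'[OF ex1])
  moreover have "assembly k (Suc n) (attach j F) =
      Adj (THE q. attaching_path k n (assembly k n F) ?l q)"
    by (simp add: truncate_forest_attach[OF F j] parent_label_attach[OF F j])
  ultimately show "\<exists>u q. assembly k (Suc n) (attach j F) = Adj q \<and>
      dpath (action_graph k n) u q (assembly k n F) \<and> vlab (action_graph k n) u = ?l"
    unfolding attaching_path_iff by blast
qed

text \<open>Converts the label bound of \<open>ancestor_labels_adjoined\<close> into the prefix of
  \<open>attach_positions_attach\<close>.\<close>

lemma sorted_wrt_less_below_nth:
  assumes "sorted_wrt (<) (xs :: nat list)" "j < length xs"
  shows "{x \<in> set xs. x \<le> xs ! j} = set (take (Suc j) xs)"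
proof -
  have le_iff: "xs ! i \<le> xs ! j \<longleftrightarrow> i \<le> j" if "i < length xs" for i
    using assms that sorted_wrt_nth_less[OF assms(1), of i j] sorted_wrt_nth_less[OF assms(1), of j i]
    by (cases i j rule: linorder_cases) auto
  have "{x \<in> set xs. x \<le> xs ! j} = nth xs ` {i. i < length xs \<and> xs ! i \<le> xs ! j}"
    unfolding set_conv_nth by blast
  also have "{i. i < length xs \<and> xs ! i \<le> xs ! j} = {0..<Suc j}"
    using le_iff assms(2) by (auto simp del: nth_mem)
  also have "nth xs ` {0..<Suc j} = set (take (Suc j) xs)"
    using assms(2) by (simp add: nth_image)
  finally show ?thesis .
qed

lemma assembly_bij_ancestors:
  "bij_betw (assembly k n) (planar_forests k n) (top_vertices k n) \<and>
   (\<forall>F \<in> planar_forests k n. ancestor_labels (action_graph k n) (assembly k n F) =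
      (\<lambda>i. int i - int k) ` set (attach_positions F))"
proof (induction n)
  case 0
  have "top_vertices k 0 = {Base 0}"
    by (auto simp: top_vertices_def initial_graph_def Let_def)
  moreover have "ancestor_labels (action_graph k 0) (Base 0) = (\<lambda>i. int i - int k) ` {0..<Suc k}"
  proof -
    have "l \<in> (\<lambda>i. int i - int k) ` {0..<Suc k}" if "- int k \<le> l" "l \<le> 0" for l
      using that by (intro image_eqI[of _ _ "nat (l + int k)"]) auto
    then show ?thesis unfolding ancestor_labels_initial by auto
  qed
  ultimately show ?case
    by (simp add: planar_forests_0 attach_positions_0 bij_betw_def del: replicate_Suc upt_Suc action_graph.simps)
next
  case (Suc n)
  let ?G = "action_graph k n"
  have inj: "inj_on (assembly k n) (planar_forests k n)"
    and img: "assembly k n ` planar_forests k n = top_vertices k n"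
    using Suc by (auto simp: bij_betw_def)
  have top: "assembly k n F \<in> top_vertices k n" if "F \<in> planar_forests k n" for F
    using that img by blast
  have anc: "ancestor_labels ?G (assembly k n F) = (\<lambda>i. int i - int k) ` set (attach_positions F)"
    if "F \<in> planar_forests k n" for F
    using that Suc by blast
  \<comment> \<open>Membership of the forest is needed three times: directly and through
    \<open>top\<close> and \<open>anc\<close>.\<close>
  note step = assembly_attach[OF _ _ top anc]
  have "inj_on (assembly k (Suc n)) (planar_forests k (Suc n))"
  proof (rule inj_onI)
    fix F F'
    assume "F \<in> planar_forests k (Suc n)" "F' \<in> planar_forests k (Suc n)"
      and eq: "assembly k (Suc n) F = assembly k (Suc n) F'"
    then obtain H j H' j' where F: "F = attach j H" "F' = attach j' H'"
      and H: "H \<in> planar_forests k n" "j < length (attach_positions H)"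
      and H': "H' \<in> planar_forests k n" "j' < length (attach_positions H')"
      unfolding planar_forests_Suc by blast
    obtain u q where q: "assembly k (Suc n) F = Adj q" "dpath ?G u q (assembly k n H)"
      "vlab ?G u = int (attach_positions H ! j) - int k"
      using step[OF H(1) H(2) H(1) H(1)] unfolding F(1) by blast
    obtain u' q' where q': "assembly k (Suc n) F' = Adj q'" "dpath ?G u' q' (assembly k n H')"
      "vlab ?G u' = int (attach_positions H' ! j') - int k"
      using step[OF H'(1) H'(2) H'(1) H'(1)] unfolding F(2) by blast
    have "q' = q" using eq q(1) q'(1) by simp
    \<comment> \<open>A path determines both its ends. The terminal vertex recovers \<open>H\<close>
      by injectivity at stage \<open>n\<close>, and the label of the initial vertex recovers
      \<open>j\<close>.\<close>
    then have "assembly k n H = assembly k n H'" "u = u'"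
      using dpath_snd_last[OF q(2)] dpath_snd_last[OF q'(2)]
        dpath_fst_hd[OF q(2)] dpath_fst_hd[OF q'(2)] by simp_all
    then have "H = H'" "attach_positions H ! j = attach_positions H' ! j'"
      using inj H(1) H'(1) q(3) q'(3) by (auto dest: inj_onD)
    moreover have "distinct (attach_positions H)"
      using sorted_attach_positions[of H] strict_sorted_iff by blast
    ultimately show "F = F'"
      using F H H' by (simp add: nth_eq_iff_index_eq)
  qed
  moreover have "assembly k (Suc n) ` planar_forests k (Suc n) = top_vertices k (Suc n)"
  proof (intro equalityI subsetI)
    fix x assume "x \<in> assembly k (Suc n) ` planar_forests k (Suc n)"
    then obtain H j where x: "x = assembly k (Suc n) (attach j H)"
      and H: "H \<in> planar_forests k n" "j < length (attach_positions H)"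
      unfolding planar_forests_Suc by blast
    obtain u q where "x = Adj q" "dpath ?G u q (assembly k n H)"
      using step[OF H(1) H(2) H(1) H(1)] unfolding x by blast
    then show "x \<in> top_vertices k (Suc n)"
      using top[OF H(1)] unfolding top_vertices_Suc
      by (auto simp: paths_to_label_def top_vertices_def)
  next
    fix x assume "x \<in> top_vertices k (Suc n)"
    then obtain q u v where x: "x = Adj q" and q: "dpath ?G u q v" and v: "vlab ?G v = int n"
      unfolding top_vertices_Suc by (auto simp: paths_to_label_def)
    have vG: "v \<in> vertices ?G" by (rule dpath_terminal_vertex[OF q])
    with v obtain H where H: "H \<in> planar_forests k n" "v = assembly k n H"
      using img by (auto simp: top_vertices_def)
    \<comment> \<open>The invariant turns this ancestor label into a candidate index
      \<open>j\<close> for \<open>H\<close>.\<close>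
    have "vlab ?G u \<in> ancestor_labels ?G v"
      using action_graph.ex_dpath_iff[OF vG] q unfolding ancestor_labels_def by blast
    then obtain j where j: "j < length (attach_positions H)"
      and u: "vlab ?G u = int (attach_positions H ! j) - int k"
      unfolding H(2) anc[OF H(1)] by (auto simp: in_set_conv_nth)
    obtain u' q' where q': "assembly k (Suc n) (attach j H) = Adj q'"
      "dpath ?G u' q' (assembly k n H)" "vlab ?G u' = int (attach_positions H ! j) - int k"
      using step[OF H(1) j H(1) H(1)] by blast
    then have "q = q'"
      using action_graph.dpath_unique[OF q, of u' q'] u H(2) by simp
    moreover have "attach j H \<in> planar_forests k (Suc n)"
      using H(1) j unfolding planar_forests_Suc by blast
    ultimately show "x \<in> assembly k (Suc n) ` planar_forests k (Suc n)"
      using x q'(1) by (metis image_eqI)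
  qed
  moreover have "ancestor_labels (action_graph k (Suc n)) (assembly k (Suc n) F) =
      (\<lambda>i. int i - int k) ` set (attach_positions F)"
    if FS: "F \<in> planar_forests k (Suc n)" for F
  proof -
    obtain H j where F: "F = attach j H"
      and H: "H \<in> planar_forests k n" "j < length (attach_positions H)"
      using FS unfolding planar_forests_Suc by blast
    obtain u q where q: "assembly k (Suc n) F = Adj q" "dpath ?G u q (assembly k n H)"
      "vlab ?G u = int (attach_positions H ! j) - int k"
      using step[OF H(1) H(2) H(1) H(1)] unfolding F by blast
    have "{l \<in> ancestor_labels ?G (assembly k n H). l \<le> vlab ?G u} =
        (\<lambda>i. int i - int k) ` {i \<in> set (attach_positions H). i \<le> attach_positions H ! j}"
      unfolding anc[OF H(1)] q(3) by auto
    also have "\<dots> = (\<lambda>i. int i - int k) ` set (take (Suc j) (attach_positions H))"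
      by (simp only: sorted_wrt_less_below_nth[OF sorted_attach_positions H(2)])
    finally have "ancestor_labels (action_graph k (Suc n)) (Adj q) =
        insert (int n + 1) ((\<lambda>i. int i - int k) ` set (take (Suc j) (attach_positions H)))"
      by (simp only: ancestor_labels_adjoined[OF q(2) top[OF H(1)]])
    \<comment> \<open>The position of the appended vertex yields exactly the label of the new
      leaf.\<close>
    moreover have "int (length (forest_vertices H)) - int k = int n + 1"
      using H(1) by (simp add: length_forest_vertices planar_forests_def)
    ultimately show ?thesis
      unfolding q(1) unfolding F attach_positions_attach[OF H(2)] by simp
  qed
  ultimately show ?case unfolding bij_betw_def by blast
qed

text \<open>The first conjunct is well-definedness: at each stage below \<open>n\<close>, the
  \<open>THE\<close> in \<open>assembly\<close> denotes an existing, unique attaching path.\<close>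

theorem theorem5p3:
  fixes k n :: nat
  shows "(\<forall>m<n. \<forall>F \<in> planar_forests k (Suc m).
            \<exists>!q. attaching_path k m (assembly k m (truncate_forest k m F)) (parent_label k m F) q)
       \<and> bij_betw (assembly k n) (planar_forests k n)
            (leaves (action_graph k n) (action_root k))"
proof (intro conjI allI impI ballI)
  show "bij_betw (assembly k n) (planar_forests k n) (leaves (action_graph k n) (action_root k))"
    using assembly_bij_ancestors by (simp add: leaves_eq_top_vertices)
next
  fix m F assume "F \<in> planar_forests k (Suc m)"
  then obtain H j where F: "F = attach j H"
    and H: "H \<in> planar_forests k m" "j < length (attach_positions H)"
    unfolding planar_forests_Suc by blast
  have "assembly k m H \<in> top_vertices k m"
    using assembly_bij_ancestors[of k m] H(1) bij_betwE by blast
  moreover have "ancestor_labels (action_graph k m) (assembly k m H) =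
      (\<lambda>i. int i - int k) ` set (attach_positions H)"
    using assembly_bij_ancestors[of k m] H(1) by blast
  ultimately show "\<exists>!q. attaching_path k m (assembly k m (truncate_forest k m F)) (parent_label k m F) q"
    unfolding F by (rule ex1_attaching_path_assembly[OF H])
qed

end
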